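(* Fix $r\ge1$. For $n,k\ge0$ let $p_n^{(k)}$ be the number of two-stack-sortable $k$-tuple $r$-permutations $(\alpha_1,\dots,\alpha_k)$ of $[n]$, where components are allowed to be empty. Let $p_k=\sum_{n\ge0}p_n^{(k)}x^n$ and $P=\sum_{k\ge0}p_k\bar z^{\,k}$. Then $$P=\frac{1}{1-\bar z}+\frac{xP}{\bar z^{\,r}}\left(P-\sum_{i=0}^r p_i\bar z^{\,i}\right),$$ and $P$ is uniquely determined as a power series in $x$ and $\bar z$ by this functional equation.
   Context: An $r$-permutation of a finite set $A$ of positive integers is a word in which each element of $A$ appears exactly $r$ times such that whenever $i<j<k$ and $a_i=a_k$ we have $a_j\le a_i$. A $k$-tuple $r$-permutation of $[n]$ is a tuple $(\alpha_1,\dots,\alpha_k)$ of words whose concatenation is an $r$-permutation of $[n]$ and in which every letter appears in only one $\alpha_i$. Stack sorting $S$: on words with distinct letters, $S(\emptyset)=\emptyset$ and $S(\pi_lm\pi_r)=S(\pi_l)S(\pi_r)m$ with $m$ the largest letter; on a nonempty $r$-permutation with largest letter $m$, written $\alpha_1m\alpha_2m\cdots m\alpha_{r+1}$, $S(\pi)=S(\alpha_1)\cdots S(\alpha_{r+1})m$; $S(\emptyset)=\emptyset$. The tuple is two-stack-sortable if $S(S(\alpha_1)S(\alpha_2)\cdots S(\alpha_k))=12\cdots n$. (For $k=0$ there is only the empty tuple, with $n=0$.) *)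

theory Defs
  imports "HOL-Computational_Algebra.Formal_Power_Series"
begin

definition r_permutation :: "nat \<Rightarrow> nat set \<Rightarrow> nat list \<Rightarrow> bool" where
  "r_permutation r A w \<longleftrightarrow>
     finite A \<and> 0 \<notin> A \<and> set w \<subseteq> A \<and> (\<forall>a\<in>A. count_list w a = r) \<and>
     (\<forall>i j k. i < j \<and> j < k \<and> k < length w \<and> w ! i = w ! k \<longrightarrow> w ! j \<le> w ! i)"

definition tuple_r_permutation :: "nat \<Rightarrow> nat \<Rightarrow> nat \<Rightarrow> nat list list \<Rightarrow> bool" where
  "tuple_r_permutation r n k \<alpha> \<longleftrightarrow>
     length \<alpha> = k \<and> r_permutation r {1..n} (concat \<alpha>) \<and>
     (\<forall>i<k. \<forall>j<k. i \<noteq> j \<longrightarrow> set (\<alpha> ! i) \<inter> set (\<alpha> ! j) = {})"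

fun split_at :: "'a \<Rightarrow> 'a list \<Rightarrow> 'a list list" where
  "split_at m [] = [[]]"
| "split_at m (x # xs) =
     (if x = m then [] # split_at m xs
      else (x # hd (split_at m xs)) # tl (split_at m xs))"

lemma split_at_not_Nil: "split_at m xs \<noteq> []"
  by (cases xs) auto

lemma split_at_length_le: "u \<in> set (split_at m xs) \<Longrightarrow> length u \<le> length xs"
proof (induction xs arbitrary: u)
  case (Cons x xs)
  show ?case
  proof (cases "x = m")
    case True
    with Cons show ?thesis by fastforce
  next
    case False
    with Cons.prems have "u = x # hd (split_at m xs) \<or> u \<in> set (tl (split_at m xs))"
      by simp
    with Cons.IH split_at_not_Nil[of m xs] show ?thesis
      by (metis hd_in_set le_SucI length_Cons list.set_sel(2) Suc_le_mono)
  qed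
qed simp

lemma split_at_length_less:
  "m \<in> set xs \<Longrightarrow> u \<in> set (split_at m xs) \<Longrightarrow> length u < length xs"
proof (induction xs arbitrary: u)
  case (Cons x xs)
  show ?case
  proof (cases "x = m")
    case True
    with Cons.prems split_at_length_le[of u m xs] show ?thesis by auto
  next
    case False
    with Cons.prems have "m \<in> set xs"
      "u = x # hd (split_at m xs) \<or> u \<in> set (tl (split_at m xs))"
      by simp_all
    with Cons.IH split_at_not_Nil[of m xs] show ?thesis
      by (metis hd_in_set less_SucI length_Cons list.set_sel(2) Suc_less_eq)
  qed
qed simp

text \<open>
  One function covers both kinds of words: the largest letter occurs once in a nonempty
  word with distinct letters and \<open>r\<close> times in a nonempty \<open>r\<close>-permutation.  The lemmas
  \<open>stack_sort_distinct\<close> and \<open>stack_sort_blocks\<close> below are the two usual recursions.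
\<close>

function stack_sort :: "nat list \<Rightarrow> nat list" where
  "stack_sort w =
     (if w = [] then []
      else concat (map stack_sort (split_at (Max (set w)) w)) @ [Max (set w)])"
  by auto
termination
  by (relation "measure length") (auto intro: split_at_length_less Max_in)

declare stack_sort.simps [simp del]

lemma split_at_notin: "m \<notin> set u \<Longrightarrow> split_at m u = [u]"
  by (induction u) auto

lemma split_at_append: "m \<notin> set u \<Longrightarrow> split_at m (u @ m # v) = u # split_at m v"
  by (induction u) auto

lemma split_at_blocks:
  assumes "\<forall>u\<in>set (a # as). m \<notin> set u"
  shows "split_at m (a @ concat (map (\<lambda>u. m # u) as)) = a # as"
  using assms
  by (induction as arbitrary: a) (auto simp: split_at_notin split_at_append)

lemma stack_sort_Nil: "stack_sort [] = []"
  by (simp add: stack_sort.simps)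

lemma stack_sort_blocks:
  assumes "as \<noteq> []" and less: "\<forall>u\<in>set (a # as). \<forall>x\<in>set u. x < m"
  shows "stack_sort (a @ concat (map (\<lambda>u. m # u) as)) = concat (map stack_sort (a # as)) @ [m]"
proof -
  let ?w = "a @ concat (map (\<lambda>u. m # u) as)"
  have mem: "m \<in> set ?w" using assms(1) by (cases as) auto
  have "Max (set ?w) = m"
    by (rule Max_eqI) (use less mem in \<open>auto simp: less_imp_le split: if_splits\<close>)
  moreover have "?w \<noteq> []" using mem by force
  moreover have "split_at m ?w = a # as"
    by (rule split_at_blocks) (use less in blast)
  ultimately show ?thesis by (subst stack_sort.simps) simp
qed

lemma stack_sort_distinct:
  assumes "\<forall>x\<in>set u \<union> set v. x < m"
  shows "stack_sort (u @ m # v) = stack_sort u @ stack_sort v @ [m]"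
  using stack_sort_blocks[of "[v]" u m] assms by auto

definition two_stack_sortable :: "nat \<Rightarrow> nat list list \<Rightarrow> bool" where
  "two_stack_sortable n \<alpha> \<longleftrightarrow> stack_sort (concat (map stack_sort \<alpha>)) = [1..<Suc n]"

definition num_tss :: "nat \<Rightarrow> nat \<Rightarrow> nat \<Rightarrow> nat" where
  "num_tss r n k = card {\<alpha>. tuple_r_permutation r n k \<alpha> \<and> two_stack_sortable n \<alpha>}"

definition p_series :: "nat \<Rightarrow> nat \<Rightarrow> 'a::field_char_0 fps" where
  "p_series r k = Abs_fps (\<lambda>n. of_nat (num_tss r n k))"

text \<open>
  Power series in \<open>x\<close> and \<open>z\<close> have type \<open>'a fps fps\<close>: the outer indeterminate
  \<open>fps_X\<close> is \<open>z\<close>, and \<open>x\<close> is \<open>fps_const fps_X\<close>.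
\<close>

definition P_series :: "nat \<Rightarrow> 'a::field_char_0 fps fps" where
  "P_series r = Abs_fps (\<lambda>k. p_series r k)"

abbreviation (input) x_var :: "'a::field_char_0 fps fps" where
  "x_var \<equiv> fps_const fps_X"

abbreviation (input) z_var :: "'a::field_char_0 fps fps" where
  "z_var \<equiv> fps_X"

text \<open>
  Division on \<open>'a fps fps\<close> is total; the next two lemmas show that the divisions by
  \<open>1 - z\<close> and by \<open>z ^ r\<close> in the functional equation are exact.  Attaching the division
  by \<open>z ^ r\<close> to the divisible factor keeps every term inside the power series ring.
\<close>

lemma one_div_one_minus_z:
  "(1 / (1 - z_var)) * (1 - z_var) = (1 :: 'a::field_char_0 fps fps)"
proof -
  have "(1 - fps_X :: 'a fps fps) * fps_right_inverse (1 - fps_X) 1 = 1"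
    by (rule fps_right_inverse) simp
  moreover have "1 / (1 - fps_X) = (fps_right_inverse (1 - fps_X) 1 :: 'a fps fps)"
  proof -
    have one: "inverse (fps_nth (1 - fps_X :: 'a fps fps) 0) = 1"
      using fps_inverse_one by simp
    have "1 / (1 - fps_X) = (1 * inverse (1 - fps_X) :: 'a fps fps)"
      by (rule fps_divide_unit') simp
    then show ?thesis
      unfolding fps_inverse_def[of "1 - fps_X :: 'a fps fps"] one by simp
  qed
  ultimately show ?thesis
    by (metis mult.commute)
qed

lemma tail_div_z_power:
  fixes Q :: "'a::field_char_0 fps fps" and r :: nat
  defines "T \<equiv> Q - (\<Sum>i=0..r. fps_const (fps_nth Q i) * z_var ^ i)"
  shows "T / z_var ^ r * z_var ^ r = T"
proof -
  have "T / fps_X ^ r = fps_shift r T"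
    by (rule fps_divide_X_power') simp
  moreover have "fps_nth T j = 0" if "j < r" for j
    using that by (simp add: T_def fps_sum_nth if_distrib[of "(*) _"] cong: if_cong)
  ultimately show ?thesis
    by (auto simp: fps_eq_iff fps_X_power_mult_right_nth)
qed

end

(*
  The largest letter m = n + 1 of a two-stack-sortable k-tuple lies in a single component
  b_0 m b_1 m ... m b_r, say the one at index i < k.  Replacing that component by
  b_0, ..., b_r and cutting the tuple behind b_r gives an (i + r + 1)-tuple and a
  (k - 1 - i)-tuple with disjoint letters.  The first pass of stack sorting moves m to the
  end of its component, so the second pass sorts the two parts separately:
  the first must sort to 1 ... s and the second to s + 1 ... n.  As sorting commutes with
  order-preserving relabelling, this gives
    p_{n+1}^(k) = sum_{i<k} sum_{s<=n} p_s^(i+r+1) p_{n-s}^(k-1-i),    p_0^(k) = 1,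
  which is the functional equation read off coefficientwise; the recursion determines
  every coefficient.
*)
theory Submission
  imports Defs
begin

section \<open>Words and tuples whose letter set is left implicit\<close>

definition nested :: "nat list \<Rightarrow> bool" where
  "nested w \<longleftrightarrow> (\<forall>i j k. i < j \<and> j < k \<and> k < length w \<and> w ! i = w ! k \<longrightarrow> w ! j \<le> w ! i)"

text \<open>An \<open>r\<close>-permutation of its own letters; that these letters are
  \<open>1, ..., n\<close> is read off later from the sorted output.\<close>

definition r_word :: "nat \<Rightarrow> nat list \<Rightarrow> bool" where
  "r_word r w \<longleftrightarrow> nested w \<and> (\<forall>a\<in>set w. count_list w a = r)"

definition disjoint_words :: "nat list list \<Rightarrow> bool" where
  "disjoint_words \<alpha> \<longleftrightarrow> sorted_wrt (\<lambda>u v. set u \<inter> set v = {}) \<alpha>"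

text \<open>
  All \<open>r\<close> copies of a letter lie in one component, so the tuple condition is local to the
  components up to disjointness.
\<close>

definition r_tuple :: "nat \<Rightarrow> nat list list \<Rightarrow> bool" where
  "r_tuple r \<alpha> \<longleftrightarrow> disjoint_words \<alpha> \<and> (\<forall>u\<in>set \<alpha>. r_word r u)"

definition double_sort :: "nat list list \<Rightarrow> nat list" where
  "double_sort \<alpha> = stack_sort (concat (map stack_sort \<alpha>))"

text \<open>
  The letter set is not a parameter: it is the set of letters of the target \<open>l\<close>.
\<close>

definition sorting_tuples :: "nat \<Rightarrow> nat \<Rightarrow> nat list \<Rightarrow> nat list list set" where
  "sorting_tuples r k l = {\<alpha>. length \<alpha> = k \<and> r_tuple r \<alpha> \<and> double_sort \<alpha> = l}"

text \<open>The word \<open>b_0 m b_1 m ... m b_r\<close> with blocks \<open>b_0, ..., b_r\<close>,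
  in the form that \<open>split_at_blocks\<close> and \<open>stack_sort_blocks\<close> expect. On
  nonempty lists of blocks without \<open>m\<close> it is inverse to
  \<open>split_at m\<close>.\<close>

fun join :: "'a \<Rightarrow> 'a list list \<Rightarrow> 'a list" where
  "join m [] = []"
| "join m (u # us) = u @ concat (map (\<lambda>v. m # v) us)"

lemma join_Cons_Cons: "join m (u # v # us) = u @ m # join m (v # us)"
  by simp

section \<open>Nestedness under concatenation and around a largest letter\<close>

lemma nested_append:
  assumes "set u \<inter> set v = {}"
  shows "nested (u @ v) \<longleftrightarrow> nested u \<and> nested v"
proof (intro iffI conjI)
  assume n: "nested (u @ v)"
  show "nested u"
    unfolding nested_def
  proof (intro allI impI, elim conjE)
    fix i j k assume "i < j" "j < k" "k < length u" "u ! i = u ! k"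
    then show "u ! j \<le> u ! i"
      using n[unfolded nested_def, rule_format, of i j k] by (simp add: nth_append)
  qed
  show "nested v"
    unfolding nested_def
  proof (intro allI impI, elim conjE)
    fix i j k assume "i < j" "j < k" "k < length v" "v ! i = v ! k"
    then show "v ! j \<le> v ! i"
      using n[unfolded nested_def, rule_format, of "length u + i" "length u + j" "length u + k"]
      by (simp add: nth_append)
  qed
next
  assume n: "nested u \<and> nested v"
  show "nested (u @ v)"
    unfolding nested_def
  proof (intro allI impI, elim conjE)
    fix i j k assume ijk: "i < j" "j < k" "k < length (u @ v)" "(u @ v) ! i = (u @ v) ! k"
    \<comment> \<open>Equal letters at \<open>i\<close> and \<open>k\<close> lie in the same half,
      and then so does position \<open>j\<close>; the mixed case contradicts disjointness.\<close>
    consider "k < length u" | "length u \<le> i" | "i < length u" "length u \<le> k" by linarith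
    then show "(u @ v) ! j \<le> (u @ v) ! i"
    proof cases
      case 1
      then show ?thesis
        using n ijk unfolding nested_def by (auto simp: nth_append)
    next
      case 2
      then have "(u @ v) ! i = v ! (i - length u)" "(u @ v) ! j = v ! (j - length u)"
        "(u @ v) ! k = v ! (k - length u)"
        "i - length u < j - length u" "j - length u < k - length u" "k - length u < length v"
        using ijk by (auto simp: nth_append)
      then show ?thesis
        using n ijk(4) unfolding nested_def by metis
    next
      case 3
      then have "u ! i = v ! (k - length u)" "k - length u < length v"
        using ijk by (auto simp: nth_append)
      with 3(1) have "u ! i \<in> set u" "u ! i \<in> set v"
        using nth_mem by metis+
      then show ?thesis using assms by auto
    qed
  qed
qed

text \<open>The new first position can only be the left end of a pattern, and there \<open>m\<close>
  bounds everything. Further copies of \<open>m\<close> in \<open>u\<close> are allowed.\<close>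

lemma nested_Cons_max:
  assumes "\<forall>x\<in>set u. x \<le> m"
  shows "nested (m # u) \<longleftrightarrow> nested u"
proof
  assume n: "nested (m # u)"
  show "nested u"
    unfolding nested_def
  proof (intro allI impI, elim conjE)
    fix i j k assume "i < j" "j < k" "k < length u" "u ! i = u ! k"
    then show "u ! j \<le> u ! i"
      using n[unfolded nested_def, rule_format, of "Suc i" "Suc j" "Suc k"] by simp
  qed
next
  assume n: "nested u"
  show "nested (m # u)"
    unfolding nested_def
  proof (intro allI impI, elim conjE)
    fix i j k
    assume ijk: "i < j" "j < k" "k < length (m # u)" "(m # u) ! i = (m # u) ! k"
    then obtain j' k' where jk: "j = Suc j'" "k = Suc k'" "j' < k'"
      by (cases j; cases k) auto
    show "(m # u) ! j \<le> (m # u) ! i"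
    proof (cases i)
      case 0
      then show ?thesis using assms ijk jk by simp
    next
      case (Suc i')
      then show ?thesis using n ijk jk unfolding nested_def by auto
    qed
  qed
qed

text \<open>A letter on both sides would enclose the larger letter \<open>m\<close>.\<close>

lemma nested_disjoint_around_max:
  assumes "nested (u @ m # v)" "\<forall>x\<in>set u. x < m"
  shows "set u \<inter> set v = {}"
proof (rule ccontr)
  assume "set u \<inter> set v \<noteq> {}"
  then obtain x i k where "x < m" "i < length u" "u ! i = x" "k < length v" "v ! k = x"
    using assms(2) by (fastforce simp: in_set_conv_nth)
  then show False
    using assms(1)[unfolded nested_def, rule_format, of i "length u" "length u + Suc k"]
    by (simp add: nth_append)
qed

text \<open>Peels off the part before the first \<open>m\<close>. The bound on \<open>v\<close> is
  not strict because later copies of \<open>m\<close> remain in it.\<close>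

lemma nested_append_max:
  assumes "\<forall>x\<in>set u. x < m" "\<forall>x\<in>set v. x \<le> m"
  shows "nested (u @ m # v) \<longleftrightarrow> nested u \<and> nested v \<and> set u \<inter> set v = {}"
proof -
  have "set u \<inter> set (m # v) = {}" if "set u \<inter> set v = {}"
    using that assms(1) by auto
  then show ?thesis
    using nested_disjoint_around_max[OF _ assms(1)] nested_append[of u "m # v"]
      nested_Cons_max[OF assms(2)] by blast
qed

section \<open>Tuples with pairwise disjoint components\<close>

lemma disjoint_words_Cons:
  "disjoint_words (u # \<alpha>) \<longleftrightarrow> set u \<inter> set (concat \<alpha>) = {} \<and> disjoint_words \<alpha>"
  by (auto simp: disjoint_words_def)

lemma disjoint_words_append:
  "disjoint_words (\<alpha> @ \<beta>) \<longleftrightarrow>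
     disjoint_words \<alpha> \<and> disjoint_words \<beta> \<and> set (concat \<alpha>) \<inter> set (concat \<beta>) = {}"
  by (auto simp: disjoint_words_def sorted_wrt_append)

text \<open>\<open>sorted_wrt\<close> compares only \<open>i < j\<close>; the symmetry of
  disjointness supplies the other order, as in \<open>tuple_r_permutation\<close>.\<close>

lemma disjoint_words_conv_nth:
  "disjoint_words \<alpha> \<longleftrightarrow>
     (\<forall>i<length \<alpha>. \<forall>j<length \<alpha>. i \<noteq> j \<longrightarrow> set (\<alpha> ! i) \<inter> set (\<alpha> ! j) = {})"
proof -
  have "set (\<alpha> ! i) \<inter> set (\<alpha> ! j) = {}"
    if "\<forall>i j. i < j \<longrightarrow> j < length \<alpha> \<longrightarrow> set (\<alpha> ! i) \<inter> set (\<alpha> ! j) = {}"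
      "i < length \<alpha>" "j < length \<alpha>" "i \<noteq> j" for i j
    using that by (metis Int_commute linorder_neqE_nat)
  moreover have "j < length \<alpha> \<Longrightarrow> i < j \<Longrightarrow> i < length \<alpha> \<and> i \<noteq> j" for i j
    by linarith
  ultimately show ?thesis
    unfolding disjoint_words_def sorted_wrt_iff_nth_less by blast
qed

lemma nested_concat:
  "disjoint_words \<alpha> \<Longrightarrow> nested (concat \<alpha>) \<longleftrightarrow> (\<forall>u\<in>set \<alpha>. nested u)"
proof (induction \<alpha>)
  case Nil
  then show ?case by (simp add: nested_def)
next
  case (Cons u \<alpha>)
  then show ?case by (simp add: disjoint_words_Cons nested_append)
qed

text \<open>Every copy of a letter lies in the one component that contains it, so counting there or
  in the concatenation gives the same number.\<close>

lemma count_concat_disjoint_words: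
  assumes "disjoint_words \<alpha>"
  shows "(\<forall>a\<in>set (concat \<alpha>). count_list (concat \<alpha>) a = r) \<longleftrightarrow>
    (\<forall>u\<in>set \<alpha>. \<forall>a\<in>set u. count_list u a = r)"
  using assms
proof (induction \<alpha>)
  case (Cons u \<alpha>)
  have "count_list (concat \<alpha>) a = 0" if "a \<in> set u" for a
    using Cons.prems that by (auto simp: disjoint_words_Cons count_list_0_iff)
  moreover have "count_list u a = 0" if "a \<in> set (concat \<alpha>)" for a
    using Cons.prems that by (auto simp: disjoint_words_Cons count_list_0_iff)
  ultimately have "(\<forall>a\<in>set (concat (u # \<alpha>)). count_list (concat (u # \<alpha>)) a = r) \<longleftrightarrow>
      (\<forall>a\<in>set u. count_list u a = r) \<and> (\<forall>a\<in>set (concat \<alpha>). count_list (concat \<alpha>) a = r)"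
    by (auto simp: ball_Un simp del: set_concat)
  then show ?case
    using Cons by (simp add: disjoint_words_Cons del: set_concat)
qed simp

lemma r_tuple_conv_concat:
  "r_tuple r \<alpha> \<longleftrightarrow> disjoint_words \<alpha> \<and> r_word r (concat \<alpha>)"
  using nested_concat[of \<alpha>] count_concat_disjoint_words[of \<alpha> r]
  unfolding r_tuple_def r_word_def by blast

lemma r_tuple_append:
  "r_tuple r (\<alpha> @ \<beta>) \<longleftrightarrow>
     r_tuple r \<alpha> \<and> r_tuple r \<beta> \<and> set (concat \<alpha>) \<inter> set (concat \<beta>) = {}"
  by (auto simp: r_tuple_def disjoint_words_append)

lemma r_tuple_Cons:
  "r_tuple r (u # \<alpha>) \<longleftrightarrow> r_word r u \<and> r_tuple r \<alpha> \<and> set u \<inter> set (concat \<alpha>) = {}"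
  by (auto simp: r_tuple_def disjoint_words_Cons)

section \<open>Cutting a word at a letter and joining the blocks again\<close>

lemma set_join:
  "set (join m us) = set (concat us) \<union> (if length us \<ge> 2 then {m} else {})"
  \<comment> \<open>This rule separates lists with no, one, and at least two entries;
    \<open>m\<close> appears only in the last case.\<close>
  by (cases us rule: remdups_adj.cases) auto

lemma count_list_join:
  "us \<noteq> [] \<Longrightarrow>
   count_list (join m us) a = count_list (concat us) a + (if a = m then length us - 1 else 0)"
proof (induction us)
  case (Cons u us)
  then show ?case by (cases us) auto
qed simp

text \<open>A letter in two blocks would enclose a copy of \<open>m\<close>, while the copies of
  \<open>m\<close> themselves enclose nothing larger. The proof peels off one block at a
  time.\<close>

lemma nested_join:
  assumes "\<forall>x\<in>set (concat us). x < m"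
  shows "nested (join m us) \<longleftrightarrow> disjoint_words us \<and> (\<forall>u\<in>set us. nested u)"
  using assms
proof (induction us rule: induct_list012)
  case (3 u v us)
  have "\<forall>x\<in>set (join m (v # us)). x \<le> m"
    using 3 by (auto simp: less_imp_le)
  moreover have um: "\<forall>x\<in>set u. x < m"
    using 3 by auto
  ultimately have "nested (join m (u # v # us)) \<longleftrightarrow>
      nested u \<and> nested (join m (v # us)) \<and> set u \<inter> set (join m (v # us)) = {}"
    unfolding join_Cons_Cons by (intro nested_append_max) auto
  moreover have "set u \<inter> set (join m (v # us)) = {} \<longleftrightarrow> set u \<inter> set (concat (v # us)) = {}"
    using um unfolding set_join by auto
  moreover have "nested (join m (v # us)) \<longleftrightarrow>
      disjoint_words (v # us) \<and> (\<forall>w\<in>set (v # us). nested w)"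
    by (rule 3) (use 3 in auto)
  ultimately show ?case
    unfolding disjoint_words_Cons[of u] list.set(2)[of u] ball_simps by argo
qed (auto simp: nested_def disjoint_words_def)

text \<open>The \<open>r + 1\<close> blocks have \<open>r\<close> gaps, which gives \<open>m\<close>
  its \<open>r\<close> copies; all other counts are those of the blocks, and nestedness becomes
  disjointness of the blocks.\<close>

lemma r_word_join:
  assumes "\<forall>x\<in>set (concat us). x < m" and "length us = Suc r"
  shows "r_word r (join m us) \<longleftrightarrow> r_tuple r us"
proof -
  have us: "us \<noteq> []" using assms(2) by auto
  have m: "m \<notin> set (concat us)" using assms(1) by blast
  then have "count_list (join m us) m = r"
    using assms(2) us by (simp add: count_list_join count_list_0_iff del: set_concat)
  moreover have "count_list (join m us) a = count_list (concat us) a" if "a \<in> set (concat us)" for a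
    using that m us by (auto simp: count_list_join simp del: set_concat)
  ultimately have "(\<forall>a\<in>set (join m us). count_list (join m us) a = r) \<longleftrightarrow>
      (\<forall>a\<in>set (concat us). count_list (concat us) a = r)"
    unfolding set_join by auto
  then show ?thesis
    using nested_join[OF assms(1)] count_concat_disjoint_words[of us r]
    unfolding r_word_def r_tuple_def by blast
qed

lemma split_at_join:
  assumes "us \<noteq> []" "m \<notin> set (concat us)"
  shows "split_at m (join m us) = us"
  using assms by (cases us) (auto intro!: split_at_blocks)

lemma join_split_at: "join m (split_at m w) = w"
proof (induction w)
  case (Cons x w)
  then show ?case
    using split_at_not_Nil[of m w] by (cases "split_at m w") auto
qed simp

lemma split_at_free: "m \<notin> set (concat (split_at m w))"
proof (induction w)
  case (Cons x w)
  then show ?case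
    using split_at_not_Nil[of m w] by (cases "split_at m w") auto
qed simp

lemma set_split_at: "set w = set (concat (split_at m w)) \<union> (if m \<in> set w then {m} else {})"
proof -
  have "set w = set (concat (split_at m w)) \<union> (if length (split_at m w) \<ge> 2 then {m} else {})"
    by (metis join_split_at set_join)
  then show ?thesis by auto
qed

section \<open>Sorting preserves letters, and the count in terms of
  \<open>sorting_tuples\<close>\<close>

lemma set_stack_sort: "set (stack_sort w) = set w"
proof (induction w rule: stack_sort.induct)
  case (1 w)
  show ?case
  proof (cases "w = []")
    case False
    let ?m = "Max (set w)"
    have "set (stack_sort w) = set (concat (split_at ?m w)) \<union> {?m}"
      using 1 False by (subst stack_sort.simps) auto
    then show ?thesis
      using set_split_at[of w ?m] False by simp
  qed (simp add: stack_sort_Nil)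
qed

lemma set_double_sort: "set (double_sort \<alpha>) = set (concat \<alpha>)"
  by (simp add: double_sort_def set_stack_sort)

lemma set_concat_map_stack_sort: "set (concat (map stack_sort \<alpha>)) = set (concat \<alpha>)"
  by (simp add: set_stack_sort)

text \<open>Sorting to \<open>[1..<Suc n]\<close> forces the letter set \<open>{1..n}\<close>, so
  for sortable tuples \<open>r_permutation\<close> on that set agrees with
  \<open>r_word\<close>.\<close>

lemma num_tss_eq_card:
  assumes "r \<ge> 1"
  shows "num_tss r n k = card (sorting_tuples r k [1..<Suc n])"
proof -
  have "tuple_r_permutation r n k \<alpha> \<and> two_stack_sortable n \<alpha> \<longleftrightarrow>
      \<alpha> \<in> sorting_tuples r k [1..<Suc n]" for \<alpha>
  proof -
    have "r_permutation r {1..n} (concat \<alpha>) \<longleftrightarrow> r_word r (concat \<alpha>)"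
      if "two_stack_sortable n \<alpha>"
    proof -
      have "double_sort \<alpha> = [1..<Suc n]"
        using that by (simp only: two_stack_sortable_def double_sort_def)
      then have "set (concat \<alpha>) = {1..n}"
        using set_double_sort[of \<alpha>] by auto
      then show ?thesis
        by (auto simp add: r_permutation_def r_word_def nested_def simp del: set_concat)
    qed
    then show ?thesis
      by (auto simp: tuple_r_permutation_def sorting_tuples_def two_stack_sortable_def
          double_sort_def r_tuple_conv_concat disjoint_words_conv_nth)
  qed
  then show ?thesis
    by (simp add: num_tss_def)
qed

section \<open>Effect of the largest letter on sorting and on the tuple condition\<close>

lemma double_sort_insert_max:
  assumes "\<forall>x\<in>set (concat (\<alpha> @ us @ \<gamma>)). x < m" and "length us \<ge> 2"
  shows "double_sort (\<alpha> @ join m us # \<gamma>) = double_sort (\<alpha> @ us) @ double_sort \<gamma> @ [m]"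
proof -
  obtain u v vs where us: "us = u # v # vs"
    using assms(2) by (cases us rule: remdups_adj.cases) auto
  \<comment> \<open>The blocks leave the first pass as separate components would, followed by a
    single \<open>m\<close>. This \<open>m\<close> is then the unique largest letter of the second
    pass.\<close>
  have "stack_sort (join m us) = concat (map stack_sort us) @ [m]"
    unfolding us join.simps by (rule stack_sort_blocks) (use assms(1) us in auto)
  then have "concat (map stack_sort (\<alpha> @ join m us # \<gamma>)) =
      concat (map stack_sort (\<alpha> @ us)) @ m # concat (map stack_sort \<gamma>)"
    by simp
  moreover have "\<forall>x\<in>set (concat (map stack_sort (\<alpha> @ us))) \<union> set (concat (map stack_sort \<gamma>)). x < m"
    using assms(1) unfolding set_concat_map_stack_sort by auto
  ultimately show ?thesis
    unfolding double_sort_def by (simp only: stack_sort_distinct)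
qed

text \<open>Since \<open>m\<close> occurs in no other component, \<open>join m us\<close> is
  disjoint from these exactly when its blocks are; \<open>r_word_join\<close> treats the blocks
  among themselves.\<close>

lemma r_tuple_insert_max:
  assumes "\<forall>x\<in>set (concat (\<alpha> @ us @ \<gamma>)). x < m" and "length us = Suc r"
  shows "r_tuple r (\<alpha> @ join m us # \<gamma>) \<longleftrightarrow>
    r_tuple r (\<alpha> @ us) \<and> r_tuple r \<gamma> \<and> set (concat (\<alpha> @ us)) \<inter> set (concat \<gamma>) = {}"
proof -
  have m: "m \<notin> set (concat \<alpha>)" "m \<notin> set (concat us)" "m \<notin> set (concat \<gamma>)"
    using assms(1) by auto
  have "r_word r (join m us) \<longleftrightarrow> r_tuple r us"
    by (rule r_word_join) (use assms in auto)
  moreover have "set (join m us) \<inter> A = {} \<longleftrightarrow> set (concat us) \<inter> A = {}"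
    "A \<inter> set (join m us) = {} \<longleftrightarrow> A \<inter> set (concat us) = {}" if "m \<notin> A" for A
    using that by (auto simp: set_join simp del: set_concat)
  ultimately show ?thesis
    using m unfolding r_tuple_append r_tuple_Cons concat.simps concat_append set_append
      Int_Un_distrib Int_Un_distrib2 Un_empty by metis
qed

section \<open>Finiteness, and the bijection behind the recursion\<close>

lemma finite_sorting_tuples: "finite (sorting_tuples r k l)"
proof (rule finite_subset)
  \<comment> \<open>A component uses at most \<open>card (set l)\<close> letters, each occurring
    \<open>r\<close> times.\<close>
  let ?W = "{w. set w \<subseteq> set l \<and> length w \<le> r * card (set l)}"
  show "finite {\<alpha>. set \<alpha> \<subseteq> ?W \<and> length \<alpha> = k}"
    by (intro finite_lists_length_eq finite_lists_length_le) simp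
  have "w \<in> ?W" if "\<alpha> \<in> sorting_tuples r k l" "w \<in> set \<alpha>" for \<alpha> w
  proof -
    have w: "set w \<subseteq> set l"
      using that set_double_sort[of \<alpha>] by (auto simp: sorting_tuples_def)
    have "length w = (\<Sum>a\<in>set w. count_list w a)"
      by (simp add: sum_count_set)
    also have "\<dots> = (\<Sum>a\<in>set w. r)"
      by (rule sum.cong) (use that in \<open>auto simp: sorting_tuples_def r_tuple_def r_word_def\<close>)
    also have "\<dots> \<le> r * card (set l)"
      using w by (simp add: card_mono)
    finally show ?thesis using w by simp
  qed
  then show "sorting_tuples r k l \<subseteq> {\<alpha>. set \<alpha> \<subseteq> ?W \<and> length \<alpha> = k}"
    by (auto simp: sorting_tuples_def)
qed

text \<open>Undoes the cutting: when \<beta> has \<open>i + r + 1\<close> components, the last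
  \<open>r + 1\<close> become the blocks of the component at index \<open>i\<close>.\<close>

definition insert_max :: "nat \<Rightarrow> nat \<Rightarrow> nat list list \<Rightarrow> nat list list \<Rightarrow> nat list list" where
  "insert_max m i \<beta> \<gamma> = take i \<beta> @ join m (drop i \<beta>) # \<gamma>"

text \<open>The first component containing \<open>m\<close> marks the place of insertion: what
  precedes it is \<open>take i\<close> of \<beta>, splitting it at \<open>m\<close> returns the
  other components of \<beta>, and what follows it is \<gamma>. At least two blocks ensure that
  \<open>m\<close> does occur.\<close>

lemma insert_max_inject:
  assumes "m \<notin> set (concat \<beta>)" "length \<beta> \<ge> i + 2"
    and "m \<notin> set (concat \<beta>')" "length \<beta>' \<ge> i' + 2"
    and "insert_max m i \<beta> \<gamma> = insert_max m i' \<beta>' \<gamma>'"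
  shows "i = i' \<and> \<beta> = \<beta>' \<and> \<gamma> = \<gamma>'"
proof -
  have parts: "takeWhile (\<lambda>u. m \<notin> set u) (insert_max m i \<beta> \<gamma>) = take i \<beta> \<and>
      dropWhile (\<lambda>u. m \<notin> set u) (insert_max m i \<beta> \<gamma>) = join m (drop i \<beta>) # \<gamma> \<and>
      split_at m (join m (drop i \<beta>)) = drop i \<beta>"
    if "m \<notin> set (concat \<beta>)" "length \<beta> \<ge> i + 2" for i \<beta> \<gamma>
  proof -
    have "m \<in> set (join m (drop i \<beta>))"
      using that by (simp add: set_join)
    moreover have "\<forall>u\<in>set (take i \<beta>). m \<notin> set u"
      using that by (auto dest: in_set_takeD)
    moreover have "split_at m (join m (drop i \<beta>)) = drop i \<beta>"
      by (rule split_at_join) (use that in \<open>auto dest: in_set_dropD\<close>)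
    ultimately show ?thesis
      by (simp add: insert_max_def takeWhile_append dropWhile_append)
  qed
  from parts[OF assms(1,2), of \<gamma>] parts[OF assms(3,4), of \<gamma>'] assms(5)
  have "take i \<beta> = take i' \<beta>'" "drop i \<beta> = drop i' \<beta>'" "\<gamma> = \<gamma>'"
    by (metis, metis list.inject, metis list.inject)
  moreover from this have "\<beta> = \<beta>'"
    by (metis append_take_drop_id)
  \<comment> \<open>Both lists are long enough for the prefixes to have lengths exactly
    \<open>i\<close> and \<open>i'\<close>.\<close>
  moreover have "i = i'"
    using arg_cong[OF \<open>take i \<beta> = take i' \<beta>'\<close>, of length] assms(2,4) by simp
  ultimately show ?thesis by simp
qed

text \<open>Strict sortedness of the target puts both letter sets below \<open>m\<close> and makes
  them disjoint, as inserting \<open>m\<close> demands.\<close>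

lemma insert_max_in_sorting_tuples:
  assumes "r \<ge> 1" "sorted_wrt (<) (l\<^sub>1 @ l\<^sub>2 @ [m])" "i < k"
    and "\<beta> \<in> sorting_tuples r (i + Suc r) l\<^sub>1" "\<gamma> \<in> sorting_tuples r (k - 1 - i) l\<^sub>2"
  shows "insert_max m i \<beta> \<gamma> \<in> sorting_tuples r k (l\<^sub>1 @ l\<^sub>2 @ [m])"
proof -
  have sets: "set (concat \<beta>) = set l\<^sub>1" "set (concat \<gamma>) = set l\<^sub>2"
    using assms(4,5) set_double_sort[of \<beta>] set_double_sort[of \<gamma>]
    by (simp_all add: sorting_tuples_def)
  have "concat (take i \<beta> @ drop i \<beta> @ \<gamma>) = concat \<beta> @ concat \<gamma>"
    by (metis append_assoc append_take_drop_id concat_append)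
  then have less: "\<forall>x\<in>set (concat (take i \<beta> @ drop i \<beta> @ \<gamma>)). x < m"
    using sets assms(2) by (auto simp only: sorted_wrt_append set_append) auto
  have len: "length (drop i \<beta>) = Suc r" "length (take i \<beta>) = i" "length \<gamma> = k - 1 - i"
    using assms(4,5) by (simp_all add: sorting_tuples_def)
  have "set l\<^sub>1 \<inter> set l\<^sub>2 = {}"
    using assms(2) by (force simp: sorted_wrt_append)
  then have "r_tuple r (insert_max m i \<beta> \<gamma>)"
    using r_tuple_insert_max[OF less len(1)] assms(4,5) sets
    by (simp add: insert_max_def sorting_tuples_def)
  moreover have "double_sort (insert_max m i \<beta> \<gamma>) = l\<^sub>1 @ l\<^sub>2 @ [m]"
    using double_sort_insert_max[OF less] assms len(1)
    by (simp add: insert_max_def sorting_tuples_def)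
  moreover have "length (insert_max m i \<beta> \<gamma>) = k"
    using assms(3) len by (simp add: insert_max_def)
  ultimately show ?thesis by (simp add: sorting_tuples_def)
qed

text \<open>Surjectivity of \<open>insert_max\<close>: some component contains \<open>m\<close>, and
  it is cut at all copies of \<open>m\<close>.\<close>

lemma sorting_tuples_snocE:
  assumes "r \<ge> 1" "sorted_wrt (<) (l @ [m])" "\<alpha> \<in> sorting_tuples r k (l @ [m])"
  obtains i s \<beta> \<gamma> where "i < k" "s \<le> length l"
    "\<beta> \<in> sorting_tuples r (i + Suc r) (take s l)" "\<gamma> \<in> sorting_tuples r (k - 1 - i) (drop s l)"
    "\<alpha> = insert_max m i \<beta> \<gamma>"
proof -
  have len: "length \<alpha> = k" and tup: "r_tuple r \<alpha>" and ds: "double_sort \<alpha> = l @ [m]"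
    using assms(3) by (auto simp: sorting_tuples_def)
  have set: "set (concat \<alpha>) = insert m (set l)"
    using set_double_sort[of \<alpha>] ds by simp
  then obtain w where "w \<in> set \<alpha>" "m \<in> set w" by auto
  then obtain xs \<gamma> where split: "\<alpha> = xs @ w # \<gamma>" by (meson split_list)
  define us where "us = split_at m w"
  have w: "w = join m us" by (simp add: us_def join_split_at)
  have m_us: "m \<notin> set (concat us)" unfolding us_def by (rule split_at_free)
  \<comment> \<open>For nonempty \<open>us\<close>, joining inserts \<open>length us - 1\<close>
    copies of \<open>m\<close>, and this number must be \<open>r\<close>.\<close>
  have "us \<noteq> []" unfolding us_def by (rule split_at_not_Nil)
  moreover have "count_list (concat us) m = 0"
    using m_us unfolding count_list_0_iff .
  moreover have "count_list w m = r"
    using tup \<open>m \<in> set w\<close> split by (auto simp: r_tuple_def r_word_def)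
  ultimately have us: "length us = Suc r"
    using count_list_join[of us m m] w by (cases us) auto
  \<comment> \<open>By disjointness \<open>m\<close> occurs only in \<open>w\<close>, so outside the
    copies of \<open>m\<close> all letters belong to \<open>l\<close> and are smaller.\<close>
  have "set (concat us) \<subseteq> set w" unfolding w set_join by auto
  moreover have "m \<notin> set (concat xs)" "m \<notin> set (concat \<gamma>)"
    using tup \<open>m \<in> set w\<close> unfolding split r_tuple_append r_tuple_Cons by auto
  ultimately have "set (concat (xs @ us @ \<gamma>)) \<subseteq> set l"
    using set m_us unfolding split by (auto simp del: set_concat)
  then have less: "\<forall>x\<in>set (concat (xs @ us @ \<gamma>)). x < m"
    using assms(2) by (auto simp: sorted_wrt_append simp del: set_concat)
  have tups: "r_tuple r (xs @ us)" "r_tuple r \<gamma>"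
    using r_tuple_insert_max[OF less us] tup unfolding split w by auto
  have l: "l = double_sort (xs @ us) @ double_sort \<gamma>"
    using double_sort_insert_max[OF less] us assms(1) ds unfolding split w by simp
  show thesis
  \<comment> \<open>The index \<open>i\<close> is the number of components before \<open>w\<close>,
    and \<open>s\<close> is the length of the sorted first part.\<close>
  proof (rule that)
    show "length xs < k" using len split by simp
    show "length (double_sort (xs @ us)) \<le> length l" using l by simp
    show "xs @ us \<in> sorting_tuples r (length xs + Suc r) (take (length (double_sort (xs @ us))) l)"
      using tups l us by (simp add: sorting_tuples_def)
    show "\<gamma> \<in> sorting_tuples r (k - 1 - length xs) (drop (length (double_sort (xs @ us))) l)"
      using tups l len split by (simp add: sorting_tuples_def)
    show "\<alpha> = insert_max m (length xs) (xs @ us) \<gamma>"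
      by (simp add: insert_max_def split w)
  qed
qed

text \<open>\<open>insert_max\<close> is a bijection from the data
  \<open>((i, s), (\<beta>, \<gamma>))\<close> onto the tuples counted on the left.\<close>

lemma card_sorting_tuples_snoc:
  assumes "r \<ge> 1" "sorted_wrt (<) (l @ [m])"
  shows "card (sorting_tuples r k (l @ [m])) =
    (\<Sum>i<k. \<Sum>s\<le>length l. card (sorting_tuples r (i + Suc r) (take s l)) *
       card (sorting_tuples r (k - 1 - i) (drop s l)))"
proof -
  let ?T = "sorting_tuples r"
  let ?D = "SIGMA p:{..<k} \<times> {..length l}.
    ?T (fst p + Suc r) (take (snd p) l) \<times> ?T (k - 1 - fst p) (drop (snd p) l)"
  let ?f = "\<lambda>(p, q). insert_max m (fst p) (fst q) (snd q)"
  have "bij_betw ?f ?D (?T k (l @ [m]))"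
  proof (rule bij_betw_imageI)
    show "inj_on ?f ?D"
    proof (rule inj_onI, clarsimp)
      fix i s \<beta> \<gamma> i' s' \<beta>' \<gamma>'
      assume le: "s \<le> length l" "s' \<le> length l"
        and mem: "\<beta> \<in> ?T (Suc (i + r)) (take s l)" "\<beta>' \<in> ?T (Suc (i' + r)) (take s' l)"
        and eq: "insert_max m i \<beta> \<gamma> = insert_max m i' \<beta>' \<gamma>'"
      have ml: "m \<notin> set l" using assms(2) by (auto simp: sorted_wrt_append)
      have "m \<notin> set (concat \<beta>)" "m \<notin> set (concat \<beta>')"
        using mem set_double_sort[of \<beta>] set_double_sort[of \<beta>'] ml
        by (auto simp: sorting_tuples_def simp del: set_concat dest: in_set_takeD)
      then have *: "i = i' \<and> \<beta> = \<beta>' \<and> \<gamma> = \<gamma>'"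
        using insert_max_inject[OF _ _ _ _ eq] mem assms(1) by (simp add: sorting_tuples_def)
      \<comment> \<open>The parameter \<open>s\<close> is not visible in \<open>insert_max\<close>;
        it is recovered as the length of the word to which \<beta> sorts.\<close>
      then have "take s l = take s' l" using mem by (simp add: sorting_tuples_def)
      then have "s = s'" using le by (metis length_take min.absorb2)
      with * show "i = i' \<and> s = s' \<and> \<beta> = \<beta>' \<and> \<gamma> = \<gamma>'" by simp
    qed
    show "?f ` ?D = ?T k (l @ [m])"
    proof (intro equalityI subsetI)
      fix \<alpha> assume "\<alpha> \<in> ?f ` ?D"
      then obtain i s \<beta> \<gamma> where "i < k" "s \<le> length l" "\<beta> \<in> ?T (i + Suc r) (take s l)"
        "\<gamma> \<in> ?T (k - 1 - i) (drop s l)" "\<alpha> = insert_max m i \<beta> \<gamma>"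
        by auto
      then show "\<alpha> \<in> ?T k (l @ [m])"
        using insert_max_in_sorting_tuples[of r "take s l" "drop s l" m i k \<beta> \<gamma>] assms
        by (simp add: append_assoc[symmetric] del: append_assoc)
    next
      fix \<alpha> assume "\<alpha> \<in> ?T k (l @ [m])"
      then obtain i s \<beta> \<gamma> where "i < k" "s \<le> length l" "\<beta> \<in> ?T (i + Suc r) (take s l)"
        "\<gamma> \<in> ?T (k - 1 - i) (drop s l)" "\<alpha> = insert_max m i \<beta> \<gamma>"
        by (rule sorting_tuples_snocE[OF assms])
      then show "\<alpha> \<in> ?f ` ?D"
        by (intro image_eqI[of _ _ "((i, s), (\<beta>, \<gamma>))"]) auto
    qed
  qed
  then have "card (?T k (l @ [m])) = card ?D"
    by (simp add: bij_betw_same_card)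
  also have "\<dots> = (\<Sum>p\<in>{..<k} \<times> {..length l}.
      card (?T (fst p + Suc r) (take (snd p) l)) * card (?T (k - 1 - fst p) (drop (snd p) l)))"
    by (subst card_SigmaI) (auto simp: finite_sorting_tuples card_cartesian_product)
  finally show ?thesis
    by (simp add: sum.cartesian_product case_prod_unfold)
qed

section \<open>Order-preserving relabelling of letters\<close>

lemma split_at_map:
  assumes "inj f"
  shows "split_at (f m) (map f w) = map (map f) (split_at m w)"
proof (induction w)
  case (Cons x w)
  then show ?case
    using split_at_not_Nil[of m w] by (auto simp: inj_eq[OF assms] hd_map map_tl)
qed simp

text \<open>A strictly increasing map commutes with taking the maximum and with cutting at it, hence
  with each recursion step.\<close>

lemma stack_sort_map:
  assumes "strict_mono f"
  shows "stack_sort (map f w) = map f (stack_sort w)"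
proof (induction w rule: stack_sort.induct)
  case (1 w)
  show ?case
  proof (cases "w = []")
    case False
    have Max: "Max (f ` set w) = f (Max (set w))"
      using False mono_Max_commute[OF strict_mono_mono[OF assms], of "set w"] by simp
    have "concat (map stack_sort (map (map f) (split_at (Max (set w)) w))) =
        map f (concat (map stack_sort (split_at (Max (set w)) w)))"
      using 1 False by (simp add: map_concat o_def cong: map_cong)
    then show ?thesis
      using False split_at_map[OF strict_mono_imp_inj_on[OF assms], of "Max (set w)" w]
      by (subst (1 2) stack_sort.simps) (simp add: Max)
  qed (simp add: stack_sort_Nil)
qed

lemma nested_map:
  assumes "strict_mono f"
  shows "nested (map f w) \<longleftrightarrow> nested w"
proof -
  have "f x = f y \<longleftrightarrow> x = y" "f x \<le> f y \<longleftrightarrow> x \<le> y" for x y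
    using assms by (simp_all add: strict_mono_eq strict_mono_less_eq)
  then have "(i < j \<and> j < k \<and> k < length (map f w) \<and> map f w ! i = map f w ! k
        \<longrightarrow> map f w ! j \<le> map f w ! i) \<longleftrightarrow>
      (i < j \<and> j < k \<and> k < length w \<and> w ! i = w ! k \<longrightarrow> w ! j \<le> w ! i)" for i j k
    by (cases "i < j \<and> j < k \<and> k < length w") auto
  then show ?thesis
    by (simp only: nested_def)
qed

lemma r_tuple_map:
  assumes "strict_mono f"
  shows "r_tuple r (map (map f) \<alpha>) \<longleftrightarrow> r_tuple r \<alpha>"
proof -
  have inj: "inj f" using assms by (rule strict_mono_imp_inj_on)
  have "count_list (map f w) (f a) = count_list w a" for w a
    by (induction w) (auto simp: inj_eq[OF inj])
  then have "r_word r (map f w) \<longleftrightarrow> r_word r w" for w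
    by (simp add: r_word_def nested_map[OF assms])
  moreover have "disjoint_words (map (map f) \<alpha>) \<longleftrightarrow> disjoint_words \<alpha>"
    by (simp add: disjoint_words_def sorted_wrt_map image_Int[OF inj, symmetric])
  ultimately show ?thesis by (simp add: r_tuple_def)
qed

lemma double_sort_map:
  assumes "strict_mono f"
  shows "double_sort (map (map f) \<alpha>) = map f (double_sort \<alpha>)"
proof -
  have "concat (map stack_sort (map (map f) \<alpha>)) = map f (concat (map stack_sort \<alpha>))"
    by (simp add: map_concat o_def stack_sort_map[OF assms])
  then show ?thesis
    by (simp add: double_sort_def stack_sort_map[OF assms])
qed

text \<open>A tuple sorting to \<open>map f l\<close> has all its letters in the range of
  \<open>f\<close>, so it can be relabelled back by \<open>inv f\<close>.\<close>

lemma card_sorting_tuples_map: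
  assumes "strict_mono f"
  shows "card (sorting_tuples r k (map f l)) = card (sorting_tuples r k l)"
proof -
  have inj: "inj f" using assms by (rule strict_mono_imp_inj_on)
  have mem: "map (map f) \<alpha> \<in> sorting_tuples r k (map f l) \<longleftrightarrow> \<alpha> \<in> sorting_tuples r k l" for \<alpha>
    by (simp add: sorting_tuples_def r_tuple_map[OF assms] double_sort_map[OF assms]
        inj_map_eq_map[OF inj])
  have "\<alpha> \<in> map (map f) ` sorting_tuples r k l" if "\<alpha> \<in> sorting_tuples r k (map f l)" for \<alpha>
  proof -
    have "set (concat \<alpha>) \<subseteq> range f"
      using that set_double_sort[of \<alpha>] by (auto simp: sorting_tuples_def)
    then have "f (inv f x) = x" if "w \<in> set \<alpha>" "x \<in> set w" for w x
      using that by (intro f_inv_into_f) auto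
    then have "\<alpha> = map (map f) (map (map (inv f)) \<alpha>)"
      by (simp add: o_def map_idI)
    then show ?thesis using that mem by (metis image_eqI)
  qed
  then have "sorting_tuples r k (map f l) = map (map f) ` sorting_tuples r k l"
    using mem by blast
  then show ?thesis
    using inj by (simp add: card_image inj_map inj_on_subset[OF inj_mapI[OF inj_mapI[OF inj]]])
qed

section \<open>Initial values and recursion for \<open>num_tss\<close>\<close>

lemma num_tss_0:
  assumes "r \<ge> 1"
  shows "num_tss r 0 k = 1"
proof -
  have "r_tuple r (replicate k [])"
    by (induction k) (auto simp: r_tuple_Cons r_word_def nested_def r_tuple_def disjoint_words_def)
  then have "replicate k [] \<in> sorting_tuples r k []"
    by (auto simp: sorting_tuples_def double_sort_def stack_sort_Nil map_replicate_const
        simp flip: set_empty)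
  moreover have "\<alpha> = replicate k []" if "\<alpha> \<in> sorting_tuples r k []" for \<alpha>
  proof (rule replicate_eqI)
    show "length \<alpha> = k" using that by (simp add: sorting_tuples_def)
    show "w = []" if "w \<in> set \<alpha>" for w
      using \<open>\<alpha> \<in> sorting_tuples r k []\<close> that set_double_sort[of \<alpha>]
      by (simp add: sorting_tuples_def)
  qed
  ultimately have "sorting_tuples r k [] = {replicate k []}" by blast
  then show ?thesis using num_tss_eq_card[OF assms] by simp
qed

lemma num_tss_Suc:
  assumes "r \<ge> 1"
  shows "num_tss r (Suc n) k =
    (\<Sum>i<k. \<Sum>s\<le>n. num_tss r s (i + Suc r) * num_tss r (n - s) (k - 1 - i))"
proof -
  have l: "[1..<Suc (Suc n)] = [1..<Suc n] @ [Suc n]" by simp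
  have take: "card (sorting_tuples r j (take s [1..<Suc n])) = num_tss r s j" if "s \<le> n" for s j
  proof -
    have "take s [1..<Suc n] = [1..<Suc s]"
      using that by (simp add: take_upt del: upt_Suc)
    then show ?thesis by (simp only: num_tss_eq_card[OF assms])
  qed
  have drop: "card (sorting_tuples r j (drop s [1..<Suc n])) = num_tss r (n - s) j"
    if "s \<le> n" for s j
  proof -
    \<comment> \<open>The letters \<open>s + 1, ..., n\<close> are \<open>1, ..., n - s\<close>
      translated by \<open>s\<close>, so the count depends only on \<open>n - s\<close>.\<close>
    have "drop s [1..<Suc n] = map (\<lambda>x. x + s) [1..<Suc (n - s)]"
      using that by (simp add: list_eq_iff_nth_eq del: upt_Suc)
    moreover have "strict_mono (\<lambda>x. x + s)"
      by (simp add: strict_mono_def)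
    ultimately show ?thesis
      by (simp only: num_tss_eq_card[OF assms] card_sorting_tuples_map)
  qed
  have "num_tss r (Suc n) k = card (sorting_tuples r k ([1..<Suc n] @ [Suc n]))"
    by (simp only: num_tss_eq_card[OF assms] l)
  also have "\<dots> = (\<Sum>i<k. \<Sum>s\<le>length [1..<Suc n].
      card (sorting_tuples r (i + Suc r) (take s [1..<Suc n])) *
      card (sorting_tuples r (k - 1 - i) (drop s [1..<Suc n])))"
    by (rule card_sorting_tuples_snoc[OF assms]) (simp add: sorted_wrt_append del: upt_Suc)
  also have "\<dots> = (\<Sum>i<k. \<Sum>s\<le>n. num_tss r s (i + Suc r) * num_tss r (n - s) (k - 1 - i))"
    by (intro sum.cong) (simp_all add: take drop del: take_upt drop_upt upt_Suc One_nat_def)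
  finally show ?thesis .
qed

section \<open>The functional equation read off coefficientwise\<close>

lemma one_div_one_minus_z_nth: "fps_nth (1 / (1 - z_var) :: 'a::field_char_0 fps fps) k = 1"
proof -
  have "Abs_fps (\<lambda>_. 1) * (1 - z_var) = (1 :: 'a fps fps)"
    by (rule fps_ext) (simp add: right_diff_distrib)
  also have "\<dots> = 1 / (1 - z_var) * (1 - z_var)"
    by (simp only: one_div_one_minus_z)
  \<comment> \<open>The factor \<open>1 - z_var\<close> may be cancelled: it is nonzero, as it has a
    product equal to \<open>1\<close>.\<close>
  finally have "Abs_fps (\<lambda>_. 1) = (1 / (1 - z_var) :: 'a fps fps)"
    by (metis mult_right_cancel one_div_one_minus_z mult_zero_right zero_neq_one)
  then show ?thesis by (metis fps_nth_Abs_fps)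
qed

text \<open>The sum runs up to \<open>i = r\<close> inclusive, so the coefficient of
  \<open>z^r\<close> is removed as well and the shifted series has no constant term.\<close>

lemma tail_div_z_power_nth:
  fixes Q :: "'a::field_char_0 fps fps"
  shows "fps_nth ((Q - (\<Sum>i=0..r. fps_const (fps_nth Q i) * z_var ^ i)) / z_var ^ r) j =
    (if j = 0 then 0 else fps_nth Q (j + r))"
proof -
  have "fps_nth (\<Sum>i=0..r. fps_const (fps_nth Q i) * z_var ^ i) m =
      (if m \<le> r then fps_nth Q m else 0)" for m
    by (simp add: fps_sum_nth if_distrib[of "(*) _"] cong: if_cong)
  moreover have "T / z_var ^ r = fps_shift r T" if "\<forall>j<r. fps_nth T j = 0" for T :: "'a fps fps"
    by (rule fps_divide_X_power') (use that in \<open>auto intro: subdegree_geI simp: not_less\<close>)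
  ultimately show ?thesis by simp
qed

text \<open>Stated for arbitrary \<open>Q\<close>, so that one direction yields the equation for
  \<open>P_series\<close> and the other yields uniqueness. The factor \<open>x\<close> shifts the
  convolution to the coefficient of \<open>x^(n+1)\<close>, while \<open>1 / (1 - z)\<close>
  accounts for that of \<open>x^0\<close>.\<close>

lemma functional_equation_iff:
  fixes Q :: "'a::field_char_0 fps fps"
  shows "Q = 1 / (1 - z_var) + x_var * Q *
      ((Q - (\<Sum>i=0..r. fps_const (fps_nth Q i) * z_var ^ i)) / z_var ^ r) \<longleftrightarrow>
    (\<forall>k. fps_nth (fps_nth Q k) 0 = 1 \<and>
      (\<forall>n. fps_nth (fps_nth Q k) (Suc n) = (\<Sum>i<k. \<Sum>s\<le>n.
         fps_nth (fps_nth Q (i + Suc r)) s * fps_nth (fps_nth Q (k - 1 - i)) (n - s))))"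
    (is "_ = ?rhs \<longleftrightarrow> _")
proof -
  let ?T = "(Q - (\<Sum>i=0..r. fps_const (fps_nth Q i) * z_var ^ i)) / z_var ^ r"
  have QT: "fps_nth (?T * Q) k = (\<Sum>i<k. fps_nth Q (i + Suc r) * fps_nth Q (k - 1 - i))" for k
  proof -
    have "fps_nth (?T * Q) k = (\<Sum>i=0..k. fps_nth ?T i * fps_nth Q (k - i))"
      by (rule fps_mult_nth)
    \<comment> \<open>The vanishing constant term of \<open>?T\<close> makes the index start at
      \<open>1\<close>; shifting it by one produces \<open>i + Suc r\<close> and
      \<open>k - 1 - i\<close>.\<close>
    also have "\<dots> = (\<Sum>i\<in>{1..k}. fps_nth Q (i + r) * fps_nth Q (k - i))"
      by (rule sum.mono_neutral_cong_right) (auto simp: tail_div_z_power_nth)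
    also have "\<dots> = (\<Sum>i<k. fps_nth Q (i + Suc r) * fps_nth Q (k - 1 - i))"
      by (rule sum.reindex_bij_witness[of _ Suc "\<lambda>i. i - 1"]) auto
    finally show ?thesis .
  qed
  have rhs: "fps_nth ?rhs k = 1 + fps_X * fps_nth (?T * Q) k" for k
  proof -
    have "x_var * Q * ?T = fps_const fps_X * (?T * Q)" by (simp only: mult_ac)
    then show ?thesis
      by (simp only: fps_add_nth one_div_one_minus_z_nth fps_mult_left_const_nth)
  qed
  have "fps_nth (fps_nth ?rhs k) 0 = 1" for k
    by (simp only: rhs) simp
  moreover have "fps_nth (fps_nth ?rhs k) (Suc n) = (\<Sum>i<k. \<Sum>s\<le>n.
         fps_nth (fps_nth Q (i + Suc r)) s * fps_nth (fps_nth Q (k - 1 - i)) (n - s))" for k n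
  proof -
    have "fps_nth (1 + fps_X * F) (Suc n) = fps_nth F n" for F :: "'a fps"
      by simp
    then show ?thesis
      unfolding rhs QT by (simp only: fps_sum_nth fps_mult_nth atLeast0AtMost)
  qed
  moreover have "Q = R \<longleftrightarrow> (\<forall>k. fps_nth (fps_nth Q k) 0 = fps_nth (fps_nth R k) 0 \<and>
      (\<forall>n. fps_nth (fps_nth Q k) (Suc n) = fps_nth (fps_nth R k) (Suc n)))" for R
    unfolding fps_eq_iff by (metis not0_implies_Suc)
  from this[of ?rhs] show ?thesis
    unfolding calculation .
qed

theorem theorem6:
  fixes r :: nat
  assumes "r \<ge> 1"
  shows "(P_series r :: 'a::field_char_0 fps fps) =
      1 / (1 - z_var) + x_var * P_series r *
        ((P_series r - (\<Sum>i=0..r. fps_const (p_series r i) * z_var ^ i)) / z_var ^ r)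
    \<and> (\<forall>Q :: 'a fps fps.
        Q = 1 / (1 - z_var) + x_var * Q *
          ((Q - (\<Sum>i=0..r. fps_const (fps_nth Q i) * z_var ^ i)) / z_var ^ r)
        \<longrightarrow> Q = P_series r)"
proof -
  have P_nth: "fps_nth (P_series r :: 'a fps fps) k = p_series r k" for k
    by (simp add: P_series_def)
  have P_0: "fps_nth (fps_nth (P_series r :: 'a fps fps) k) 0 = 1" for k
    by (simp add: P_nth p_series_def num_tss_0[OF assms])
  have P_Suc: "fps_nth (fps_nth (P_series r :: 'a fps fps) k) (Suc n) = (\<Sum>i<k. \<Sum>s\<le>n.
      fps_nth (fps_nth (P_series r) (i + Suc r)) s *
      fps_nth (fps_nth (P_series r) (k - 1 - i)) (n - s))" for k n
    by (simp add: P_nth p_series_def num_tss_Suc[OF assms])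
  show ?thesis
  proof (intro conjI allI impI)
    show "(P_series r :: 'a fps fps) = 1 / (1 - z_var) + x_var * P_series r *
        ((P_series r - (\<Sum>i=0..r. fps_const (p_series r i) * z_var ^ i)) / z_var ^ r)"
      using functional_equation_iff[of "P_series r :: 'a fps fps" r] P_0 P_Suc
      unfolding P_nth by blast
  next
    fix Q :: "'a fps fps"
    assume "Q = 1 / (1 - z_var) + x_var * Q *
          ((Q - (\<Sum>i=0..r. fps_const (fps_nth Q i) * z_var ^ i)) / z_var ^ r)"
    note Q = this[unfolded functional_equation_iff, rule_format]
    have "fps_nth (fps_nth Q k) n = fps_nth (fps_nth (P_series r) k) n" for k n
    \<comment> \<open>The recursion lowers the exponent of \<open>x\<close> but may raise the
      exponent of \<open>z\<close> up to \<open>k + r\<close>, so the hypothesis must cover every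
      \<open>k\<close>; all exponents of \<open>x\<close> below \<open>n\<close> can occur.\<close>
    proof (induction n arbitrary: k rule: less_induct)
      case (less n)
      show ?case
      proof (cases n)
        case 0
        then show ?thesis using Q P_0 by simp
      next
        case (Suc n')
        then show ?thesis
          using less Q[THEN conjunct2, rule_format, of k n'] P_Suc[of k n'] by simp
      qed
    qed
    then show "Q = P_series r" by (simp add: fps_eq_iff)
  qed
qed

end
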